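(* Let $\chi:[n]_3\to\{+,-\}$ be a generalized signotope, and let $A,B\subseteq[n]$ be two non-empty sets. If for every $C\subseteq A\cup B$ with $|C|=4$, the sets $A\cap C$ and $B\cap C$ are separable, then $A$ and $B$ are strongly separable.
   Context: Here $[n]=\{1,2,\ldots,n\}$, and $[n]_3$ denotes the set of all triples $(a,b,c)$ with pairwise distinct $a,b,c\in[n]$. A map $\chi:[n]_3\to\{+,-\}$ is alternating if $\chi(i_{\sigma(1)},i_{\sigma(2)},i_{\sigma(3)})=\operatorname{sgn}(\sigma)\cdot\chi(i_1,i_2,i_3)$ for any distinct $i_1,i_2,i_3\in[n]$ and any permutation $\sigma\in S_3$. A generalized signotope on $n$ elements is an alternating map $\chi:[n]_3\to\{+,-\}$ such that for any pairwise different $a,b,c,d\in[n]$ the sequence $\chi(a,b,c),\chi(a,b,d),\chi(a,c,d),\chi(b,c,d)$ has at most two sign changes (equivalently, it is neither $+-+-$ nor $-+-+$). Two sets $A,B\subseteq[n]$ are separable (with respect to $\chi$) if there exist $i,j\in A\cup B$ such that $\chi(i,j,x)=+$ for all $x\in A\setminus\{i,j\}$ and $\chi(i,j,x)=-$ for all $x\in B\setminus\{i,j\}$; in this case one says that $ij$ separates $A$ from $B$. If moreover such $i,j$ can be found with $i\in A$ and $j\in B$, then $A$ and $B$ are strongly separable.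
   Formalization: The case A = B with |A| = 3 is excluded: there no four-element C exists, so the assumption is vacuous, yet A and B are not strongly separable since the third element would need both signs. *)

theory Defs
  imports "HOL-Combinatorics.Permutations" "HOL-Library.FuncSet"
begin

text \<open>
  The signs \<open>+\<close> and \<open>-\<close> are the integers \<open>1\<close> and \<open>-1\<close>, so that
  multiplication by the sign of a permutation is integer multiplication. A map
  is only constrained on \<open>triples n\<close>; its values elsewhere are irrelevant.
\<close>

definition triples :: "nat \<Rightarrow> (nat \<times> nat \<times> nat) set" where
  "triples n = {(a, b, c). {a, b, c} \<subseteq> {1..n} \<and> distinct [a, b, c]}"

definition alternating :: "nat \<Rightarrow> (nat \<times> nat \<times> nat \<Rightarrow> int) \<Rightarrow> bool" where
  "alternating n \<chi> \<longleftrightarrow>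
     (\<forall>(i :: nat \<Rightarrow> nat) (\<sigma> :: nat \<Rightarrow> nat).
        (i 1, i 2, i 3) \<in> triples n \<longrightarrow> \<sigma> permutes {1, 2, 3} \<longrightarrow>
        \<chi> (i (\<sigma> 1), i (\<sigma> 2), i (\<sigma> 3)) = sign \<sigma> * \<chi> (i 1, i 2, i 3))"

definition sign_change_count :: "int list \<Rightarrow> nat" where
  "sign_change_count s = card {k. Suc k < length s \<and> s ! k \<noteq> s ! Suc k}"

definition generalized_signotope :: "nat \<Rightarrow> (nat \<times> nat \<times> nat \<Rightarrow> int) \<Rightarrow> bool" where
  "generalized_signotope n \<chi> \<longleftrightarrow>
     \<chi> \<in> triples n \<rightarrow> {1, -1} \<and> alternating n \<chi> \<and>
     (\<forall>a b c d. {a, b, c, d} \<subseteq> {1..n} \<longrightarrow> distinct [a, b, c, d] \<longrightarrow>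
        sign_change_count [\<chi> (a, b, c), \<chi> (a, b, d), \<chi> (a, c, d), \<chi> (b, c, d)] \<le> 2)"

text \<open>
  A condition \<open>\<chi>(i,j,x) = +\<close> or \<open>\<chi>(i,j,x) = -\<close> only makes sense for a triple
  in the domain of \<open>\<chi>\<close>, so it is taken to fail outside \<open>triples n\<close>. Hence
  \<open>i = j\<close> is possible only if no condition remains, that is, only if
  \<open>A \<union> B \<subseteq> {i}\<close>.
\<close>

definition separates ::
    "nat \<Rightarrow> (nat \<times> nat \<times> nat \<Rightarrow> int) \<Rightarrow> nat \<Rightarrow> nat \<Rightarrow> nat set \<Rightarrow> nat set \<Rightarrow> bool" where
  "separates n \<chi> i j A B \<longleftrightarrow>
     (\<forall>x \<in> A - {i, j}. (i, j, x) \<in> triples n \<and> \<chi> (i, j, x) = 1) \<and>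
     (\<forall>x \<in> B - {i, j}. (i, j, x) \<in> triples n \<and> \<chi> (i, j, x) = -1)"

definition separable ::
    "nat \<Rightarrow> (nat \<times> nat \<times> nat \<Rightarrow> int) \<Rightarrow> nat set \<Rightarrow> nat set \<Rightarrow> bool" where
  "separable n \<chi> A B \<longleftrightarrow> (\<exists>i \<in> A \<union> B. \<exists>j \<in> A \<union> B. separates n \<chi> i j A B)"

definition strongly_separable ::
    "nat \<Rightarrow> (nat \<times> nat \<times> nat \<Rightarrow> int) \<Rightarrow> nat set \<Rightarrow> nat set \<Rightarrow> bool" where
  "strongly_separable n \<chi> A B \<longleftrightarrow> (\<exists>i \<in> A. \<exists>j \<in> B. separates n \<chi> i j A B)"

end

theory Submission
  imports Defs
begin

text \<open>
  Let \<open>A\<close> and \<open>B\<close> be disjoint. Separability of quadruples makes, for every \<open>a \<in> A\<close>, the orientation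
  around \<open>a\<close> a transitive tournament on \<open>B\<close>, so there is a tangent point \<open>\<beta> a \<in> B\<close>: all of \<open>B\<close> lies on
  the negative side of the line through \<open>a\<close> and \<open>\<beta> a\<close>. Say that \<open>a\<close> beats \<open>a'\<close> if \<open>a'\<close> lies on the
  positive side of this line. This relation is again a transitive tournament, and its source
  together with its tangent point separates \<open>A\<close> from \<open>B\<close>.

  If \<open>A \<inter> B\<close> has one point, every separating pair contains it, and a single tournament around
  that point suffices; two common points must themselves form the separating pair, and three are
  impossible unless \<open>A = B\<close> has three elements.
\<close>

section \<open>Sources of transitive tournaments\<close>

text \<open>A new vertex either loses to the old source, which then stays a source, or beats it and
  by transitivity beats everything.\<close>

lemma transitive_tournament_source:
  assumes "finite S" "S \<noteq> {}"
    and "\<And>x y. \<lbrakk>x \<in> S; y \<in> S; x \<noteq> y\<rbrakk> \<Longrightarrow> R x y \<or> R y x"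
    and "\<And>x y z. \<lbrakk>x \<in> S; y \<in> S; z \<in> S; distinct [x, y, z]; R x y; R y z\<rbrakk> \<Longrightarrow> R x z"
  shows "\<exists>x\<in>S. \<forall>y\<in>S - {x}. R x y"
  using assms
proof (induction S rule: finite_ne_induct)
  case (singleton x)
  show ?case by simp
next
  case (insert v S)
  have "\<exists>x\<in>S. \<forall>y\<in>S - {x}. R x y"
    by (rule insert.IH; rule insert.prems; simp)
  then obtain x where x: "x \<in> S" "\<And>y. y \<in> S - {x} \<Longrightarrow> R x y" by blast
  show ?case
  proof (cases "R x v")
    case True
    then show ?thesis using x by auto
  next
    case False
    then have vx: "R v x" using insert.prems(1)[of x v] insert.hyps x(1) by auto
    have "R v y" if "y \<in> S" for y
      using insert.prems(2)[of v x y] vx x that insert.hyps by (cases "y = x") auto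
    then show ?thesis by auto
  qed
qed

section \<open>Sign rules and separating pairs\<close>

context
  fixes n :: nat and \<chi> :: "nat \<times> nat \<times> nat \<Rightarrow> int"
  assumes signotope: "generalized_signotope n \<chi>"
begin

lemma sign_swaps:
  assumes "(a, b, c) \<in> triples n"
  shows "\<chi> (b, a, c) = - \<chi> (a, b, c)" "\<chi> (a, c, b) = - \<chi> (a, b, c)"
proof -
  \<comment> \<open>\<open>alternating\<close> permutes the positions of a family indexed by 1, 2,
    3, so the triple is packed into such a family; adjacent transpositions then give the two
    swaps.\<close>
  define i :: "nat \<Rightarrow> nat" where "i = (\<lambda>k. if k = 1 then a else if k = 2 then b else c)"
  have i: "i 1 = a" "i 2 = b" "i 3 = c" by (auto simp: i_def)
  have alt: "\<chi> (i (\<sigma> 1), i (\<sigma> 2), i (\<sigma> 3)) = sign \<sigma> * \<chi> (i 1, i 2, i 3)"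
    if "\<sigma> permutes {1, 2, 3}" for \<sigma> :: "nat \<Rightarrow> nat"
    using signotope assms that unfolding generalized_signotope_def alternating_def i by (metis i)
  have "Transposition.transpose 1 2 permutes {1, 2, 3 :: nat}" by (rule permutes_swap_id) auto
  from alt[OF this] show "\<chi> (b, a, c) = - \<chi> (a, b, c)"
    by (simp add: sign_swap_id Transposition.transpose_def i_def)
  have "Transposition.transpose 2 3 permutes {1, 2, 3 :: nat}" by (rule permutes_swap_id) auto
  from alt[OF this] show "\<chi> (a, c, b) = - \<chi> (a, b, c)"
    by (simp add: sign_swap_id Transposition.transpose_def i_def)
qed

lemma separates_commute:
  assumes "separates n \<chi> i j A B"
  shows "separates n \<chi> j i B A"
proof -
  have "(j, i, x) \<in> triples n \<and> \<chi> (j, i, x) = - \<chi> (i, j, x)" if "(i, j, x) \<in> triples n" for x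
    using sign_swaps(1)[OF that] that by (auto simp: triples_def)
  then show ?thesis using assms unfolding separates_def by (simp add: insert_commute)
qed

text \<open>Off the pair, a common point would need both signs. This restricts the separating pairs
  of every quadruple that contains common points.\<close>

lemma separates_common:
  assumes "separates n \<chi> i j A B" "x \<in> A" "x \<in> B"
  shows "x = i \<or> x = j"
proof (rule ccontr)
  assume "\<not> ?thesis"
  then have "x \<in> A - {i, j}" "x \<in> B - {i, j}" using assms by auto
  then have "\<chi> (i, j, x) = 1" "\<chi> (i, j, x) = -1"
    using assms(1) unfolding separates_def by blast+
  then show False by simp
qed

lemma sign_perms:
  assumes "(a, b, c) \<in> triples n"
  shows "\<chi> (b, a, c) = - \<chi> (a, b, c)" "\<chi> (a, c, b) = - \<chi> (a, b, c)"
    "\<chi> (c, b, a) = - \<chi> (a, b, c)" "\<chi> (b, c, a) = \<chi> (a, b, c)" "\<chi> (c, a, b) = \<chi> (a, b, c)"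
proof -
  have t: "(b, a, c) \<in> triples n" "(a, c, b) \<in> triples n" "(b, c, a) \<in> triples n"
    using assms by (auto simp: triples_def)
  show "\<chi> (b, a, c) = - \<chi> (a, b, c)" "\<chi> (a, c, b) = - \<chi> (a, b, c)"
    "\<chi> (c, b, a) = - \<chi> (a, b, c)" "\<chi> (b, c, a) = \<chi> (a, b, c)" "\<chi> (c, a, b) = \<chi> (a, b, c)"
    using sign_swaps[OF assms] sign_swaps[OF t(1)] sign_swaps[OF t(2)] sign_swaps[OF t(3)] by linarith+
qed

lemma sign_values: "(a, b, c) \<in> triples n \<Longrightarrow> \<chi> (a, b, c) = 1 \<or> \<chi> (a, b, c) = -1"
  using signotope unfolding generalized_signotope_def by (auto simp: Pi_def)

lemma not_alternating_quadruple:
  assumes "{a, b, c, d} \<subseteq> {1..n}" "distinct [a, b, c, d]"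
  shows "\<chi> (a, b, c) = \<chi> (a, b, d) \<or> \<chi> (a, b, d) = \<chi> (a, c, d) \<or> \<chi> (a, c, d) = \<chi> (b, c, d)"
proof (rule ccontr)
  assume neg: "\<not> ?thesis"
  let ?s = "[\<chi> (a, b, c), \<chi> (a, b, d), \<chi> (a, c, d), \<chi> (b, c, d)]"
  have "{k. Suc k < length ?s \<and> ?s ! k \<noteq> ?s ! Suc k} = {0, 1, 2}"
    using neg by (auto simp: less_Suc_eq numeral_eq_Suc)
  then have "sign_change_count ?s = 3" unfolding sign_change_count_def by simp
  moreover have "sign_change_count ?s \<le> 2"
    using signotope assms unfolding generalized_signotope_def by blast
  ultimately show False by simp
qed

section \<open>Separable quadruples\<close>

lemma separable_commute: "separable n \<chi> A B \<Longrightarrow> separable n \<chi> B A"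
  using separates_commute unfolding separable_def by blast

text \<open>If transitivity around \<open>d\<close> failed, \<open>d\<close> would lie inside the
  triangle \<open>a b c\<close>: a pair of vertices has the third vertex and \<open>d\<close> on the
  same side, and a pair of \<open>d\<close> and a vertex has the other two vertices on different
  sides. So no pair separates.\<close>

lemma separable_three_one:
  assumes sep: "separable n \<chi> {a, b, c} {d}"
    and V: "{a, b, c, d} \<subseteq> {1..n}" "distinct [a, b, c, d]"
    and ab: "\<chi> (a, d, b) = 1" and bc: "\<chi> (b, d, c) = 1"
  shows "\<chi> (a, d, c) = 1"
proof (rule ccontr)
  have t: "(a, b, c) \<in> triples n" "(a, b, d) \<in> triples n" "(a, c, d) \<in> triples n" "(b, c, d) \<in> triples n"
    using V by (auto simp: triples_def)
  note perms = t[THEN sign_perms(1)] t[THEN sign_perms(2)] t[THEN sign_perms(3)]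
    t[THEN sign_perms(4)] t[THEN sign_perms(5)]
  assume "\<chi> (a, d, c) \<noteq> 1"
  then have v: "\<chi> (a, b, d) = -1" "\<chi> (b, c, d) = -1" "\<chi> (a, c, d) = 1"
    using ab bc perms sign_values[OF t(3)] by auto
  \<comment> \<open>The last three signs are -, +, -, so the signotope axiom forbids a leading
    +.\<close>
  then have w: "\<chi> (a, b, c) = -1"
    using not_alternating_quadruple[OF V] sign_values[OF t(1)] by auto
  obtain i j where ij: "i \<in> {a, b, c, d}" "j \<in> {a, b, c, d}"
    and s: "separates n \<chi> i j {a, b, c} {d}"
    using sep unfolding separable_def by blast
  \<comment> \<open>Points outside the pair remain, and a triple with \<open>i = j\<close> is not in
    \<open>triples n\<close>.\<close>
  have ne: "i \<noteq> j" using s ij V(2) unfolding separates_def triples_def by auto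
  have s': "\<forall>x\<in>{a, b, c}. x \<noteq> i \<longrightarrow> x \<noteq> j \<longrightarrow> \<chi> (i, j, x) = 1"
    "\<forall>x\<in>{d}. x \<noteq> i \<longrightarrow> x \<noteq> j \<longrightarrow> \<chi> (i, j, x) = -1"
    using s unfolding separates_def by auto
  show False
    using ij by (elim insertE emptyE) (use ne s' V(2) in \<open>simp_all add: perms v w\<close>)
qed

text \<open>Four equal signs mean convex position in the cyclic order \<open>a, b, c, d\<close>, so
  the segments \<open>a c\<close> and \<open>b d\<close> cross. A side has one point of each set on
  the same side of it, and a diagonal has both points of the other set on different sides.\<close>

lemma separable_two_two:
  assumes sep: "separable n \<chi> {a, c} {b, d}"
    and V: "{a, b, c, d} \<subseteq> {1..n}" "distinct [a, b, c, d]"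
  shows "\<not> (\<chi> (a, b, c) = \<chi> (a, b, d) \<and> \<chi> (a, b, d) = \<chi> (a, c, d) \<and> \<chi> (a, c, d) = \<chi> (b, c, d))"
proof
  have t: "(a, b, c) \<in> triples n" "(a, b, d) \<in> triples n" "(a, c, d) \<in> triples n" "(b, c, d) \<in> triples n"
    using V by (auto simp: triples_def)
  note perms = t[THEN sign_perms(1)] t[THEN sign_perms(2)] t[THEN sign_perms(3)]
    t[THEN sign_perms(4)] t[THEN sign_perms(5)]
  assume "\<chi> (a, b, c) = \<chi> (a, b, d) \<and> \<chi> (a, b, d) = \<chi> (a, c, d) \<and> \<chi> (a, c, d) = \<chi> (b, c, d)"
  then have v: "\<chi> (a, b, c) = \<chi> (b, c, d)" "\<chi> (a, b, d) = \<chi> (b, c, d)" "\<chi> (a, c, d) = \<chi> (b, c, d)"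
    by auto
  obtain i j where ij: "i \<in> {a, c, b, d}" "j \<in> {a, c, b, d}"
    and s: "separates n \<chi> i j {a, c} {b, d}"
    using sep unfolding separable_def by blast
  have ne: "i \<noteq> j" using s ij V(2) unfolding separates_def triples_def by auto
  have s': "\<forall>x\<in>{a, c}. x \<noteq> i \<longrightarrow> x \<noteq> j \<longrightarrow> \<chi> (i, j, x) = 1"
    "\<forall>x\<in>{b, d}. x \<noteq> i \<longrightarrow> x \<noteq> j \<longrightarrow> \<chi> (i, j, x) = -1"
    using s unfolding separates_def by auto
  show False
    using ij by (elim insertE emptyE) (use ne s' V(2) in \<open>simp_all add: perms v\<close>)
qed

section \<open>Strong separation by the number of common points\<close>

context
  fixes A B :: "nat set"
  assumes sub: "A \<subseteq> {1..n}" "B \<subseteq> {1..n}"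
    and sep: "\<And>C. C \<subseteq> A \<union> B \<Longrightarrow> card C = 4 \<Longrightarrow> separable n \<chi> (A \<inter> C) (B \<inter> C)"
begin

lemma strongly_separable_disjoint:
  assumes disj: "A \<inter> B = {}" and ne: "A \<noteq> {}" "B \<noteq> {}"
  shows "strongly_separable n \<chi> A B"
proof -
  have fin: "finite A" "finite B" using sub finite_subset by auto
  have transA: "\<chi> (a, b, a'') = 1"
    if "a \<in> A" "a' \<in> A" "a'' \<in> A" "b \<in> B" "distinct [a, a', a'']" "\<chi> (a, b, a') = 1" "\<chi> (a', b, a'') = 1"
    for a a' a'' b
  proof (rule separable_three_one[OF _ _ _ that(6,7)])
    have "A \<inter> {a, a', a'', b} = {a, a', a''}" "B \<inter> {a, a', a'', b} = {b}" using that disj by auto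
    moreover have "card {a, a', a'', b} = 4" using that disj by (auto simp: card_insert_if)
    ultimately show "separable n \<chi> {a, a', a''} {b}" using sep[of "{a, a', a'', b}"] that by simp
  qed (use that sub disj in auto)
  have transB: "\<chi> (b, a, b'') = 1"
    if "b \<in> B" "b' \<in> B" "b'' \<in> B" "a \<in> A" "distinct [b, b', b'']" "\<chi> (b, a, b') = 1" "\<chi> (b', a, b'') = 1"
    for b b' b'' a
  proof (rule separable_three_one[OF _ _ _ that(6,7)])
    have "A \<inter> {b, b', b'', a} = {a}" "B \<inter> {b, b', b'', a} = {b, b', b''}" using that disj by auto
    moreover have "card {b, b', b'', a} = 4" using that disj by (auto simp: card_insert_if)
    ultimately show "separable n \<chi> {b, b', b''} {a}"
      using sep[of "{b, b', b'', a}"] that by (simp add: separable_commute)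
  qed (use that sub disj in auto)
  have crossing: "\<not> (\<chi> (a, b, a') = \<chi> (a, b, b') \<and> \<chi> (a, b, b') = \<chi> (a, a', b') \<and> \<chi> (a, a', b') = \<chi> (b, a', b'))"
    if "a \<in> A" "a' \<in> A" "b \<in> B" "b' \<in> B" "a \<noteq> a'" "b \<noteq> b'" for a a' b b'
  proof (rule separable_two_two)
    have "A \<inter> {a, a', b, b'} = {a, a'}" "B \<inter> {a, a', b, b'} = {b, b'}" using that disj by auto
    moreover have "card {a, a', b, b'} = 4" using that disj by (auto simp: card_insert_if)
    ultimately show "separable n \<chi> {a, a'} {b, b'}" using sep[of "{a, a', b, b'}"] that by simp
  qed (use that sub disj in auto)
  have quad: "\<chi> (a, b, a') = \<chi> (a, b, b') \<or> \<chi> (a, b, b') = \<chi> (a, a', b') \<or> \<chi> (a, a', b') = \<chi> (b, a', b')"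
    if "a \<in> A" "a' \<in> A" "b \<in> B" "b' \<in> B" "a \<noteq> a'" "b \<noteq> b'" for a a' b b'
    by (rule not_alternating_quadruple) (use that sub disj in auto)
  have aba: "(a, b, a') \<in> triples n" if "a \<in> A" "a' \<in> A" "b \<in> B" "a \<noteq> a'" for a a' b
    using that sub disj by (auto simp: triples_def)
  have abb: "(a, b, b') \<in> triples n" if "a \<in> A" "b' \<in> B" "b \<in> B" "b \<noteq> b'" for a b b'
    using that sub disj by (auto simp: triples_def)
  have "\<exists>b\<in>B. \<forall>b'\<in>B - {b}. \<chi> (b, a, b') = 1" if a: "a \<in> A" for a
  proof (rule transitive_tournament_source)
    show "\<chi> (x, a, y) = 1 \<or> \<chi> (y, a, x) = 1" if "x \<in> B" "y \<in> B" "x \<noteq> y" for x y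
      using sign_perms[OF abb[of a y x]] sign_values[OF abb[of a y x]] a that by auto
  qed (use fin ne transB a in auto)
  then obtain \<beta> where \<beta>: "\<And>a. a \<in> A \<Longrightarrow> \<beta> a \<in> B"
    "\<And>a b. a \<in> A \<Longrightarrow> b \<in> B - {\<beta> a} \<Longrightarrow> \<chi> (\<beta> a, a, b) = 1"
    by metis
  have \<beta>neg: "\<chi> (a, \<beta> a, b) = -1" if "a \<in> A" "b \<in> B" "b \<noteq> \<beta> a" for a b
    using \<beta>[OF that(1)] sign_perms(1)[OF abb[of a b "\<beta> a"]] that by auto
  let ?R = "\<lambda>a a'. \<chi> (a, \<beta> a, a') = 1"
  have R_iff: "?R a a' \<longleftrightarrow> \<not> ?R a' a" if "a \<in> A" "a' \<in> A" "a \<noteq> a'" for a a'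
  proof (cases "\<beta> a = \<beta> a'")
    case True
    then show ?thesis
      using sign_perms[OF aba[of a a' "\<beta> a"]] sign_values[OF aba[of a a' "\<beta> a"]] that \<beta>(1) by auto
  next
    case False
    note B = \<beta>(1)[OF that(1)] \<beta>(1)[OF that(2)]
    have n: "\<chi> (a, \<beta> a, \<beta> a') = -1" "\<chi> (a', \<beta> a', \<beta> a) = -1"
      using \<beta>neg that False B by auto
    \<comment> \<open>On \<open>a, \<beta> a, a', \<beta> a'\<close> the sign sequence is p, -, q,
      -, where p and q decide \<open>?R a a'\<close> and \<open>?R a' a\<close>. Two pluses violate
      the signotope axiom and two minuses give a crossing, so exactly one is plus.\<close>
    have "\<chi> (\<beta> a, a', \<beta> a') = -1" "\<chi> (a, a', \<beta> a') = \<chi> (a', \<beta> a', a)"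
      using sign_perms[OF abb[of a' "\<beta> a" "\<beta> a'"]] sign_perms[OF aba[of a' a "\<beta> a'"]] n B that False by auto
    then have "\<not> (\<chi> (a, \<beta> a, a') = -1 \<and> \<chi> (a', \<beta> a', a) = -1)"
      "\<chi> (a, \<beta> a, a') = -1 \<or> \<chi> (a', \<beta> a', a) = -1"
      using crossing[OF that(1,2) B that(3) False] quad[OF that(1,2) B that(3) False] n(1) by metis+
    then show ?thesis
      using sign_values[OF aba[OF that(1,2) B(1) that(3)]]
        sign_values[OF aba[OF that(2,1) B(2) that(3)[symmetric]]] by auto
  qed
  \<comment> \<open>Along a cyclic triangle the three tangent points are distinct. The signotope axiom then fixes the
    orientation of each vertex with the two tangent points of the other vertices, and this forces a crossing.\<close>
  have no_cycle: False
    if A: "a \<in> A" "a' \<in> A" "a'' \<in> A" and d: "distinct [a, a', a'']"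
      and R: "?R a a'" "?R a' a''" "?R a'' a" for a a' a''
  proof -
    \<comment> \<open>Around \<open>\<beta> x\<close> the point \<open>z\<close> precedes
      \<open>x\<close>, since \<open>?R x z\<close> fails, and \<open>x\<close> precedes
      \<open>y\<close>; transitivity joins the two.\<close>
    have skip: "\<chi> (z, \<beta> x, y) = 1"
      if "x \<in> A" "y \<in> A" "z \<in> A" "distinct [x, y, z]" "?R x y" "?R z x" for x y z
    proof -
      have "\<not> ?R x z" using R_iff[of x z] that by auto
      then have "\<chi> (z, \<beta> x, x) = 1"
        using sign_perms[OF aba[of x z "\<beta> x"]] sign_values[OF aba[of x z "\<beta> x"]] that \<beta>(1) by auto
      then show ?thesis using transA[of z x y "\<beta> x"] that \<beta>(1) by auto
    qed
    \<comment> \<open>If the tangent points agreed, \<open>skip\<close> would contradict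
      \<open>?R y z\<close>.\<close>
    have ne: "\<beta> x \<noteq> \<beta> y"
      if "x \<in> A" "y \<in> A" "z \<in> A" "distinct [x, y, z]" "?R x y" "?R y z" "?R z x" for x y z
      using skip[of x y z] R_iff[of y z] sign_perms(3)[OF aba[of z y "\<beta> x"]] that \<beta>(1) by auto
    have nxt: "\<chi> (y, \<beta> x, \<beta> z) = -1"
      if "x \<in> A" "y \<in> A" "z \<in> A" "distinct [x, y, z]" "?R x y" "?R y z" "?R z x" for x y z
    proof -
      note B = \<beta>(1)[OF that(1)] \<beta>(1)[OF that(2)] \<beta>(1)[OF that(3)]
      have ne': "\<beta> x \<noteq> \<beta> z" using ne[of z x y] that by auto
      have "\<chi> (x, \<beta> x, \<beta> z) = -1" using \<beta>neg[of x "\<beta> z"] that B ne' by auto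
      moreover have "\<chi> (y, \<beta> z, x) = 1" using skip[of z x y] that by auto
      then have "\<chi> (x, y, \<beta> z) = 1"
        using sign_perms[OF aba[of y x "\<beta> z"]] that B by auto
      \<comment> \<open>On \<open>x, \<beta> x, y, \<beta> z\<close> the first three signs are +, -,
        +, so the axiom forces the fourth to be +.\<close>
      ultimately have "\<chi> (\<beta> x, y, \<beta> z) = 1"
        using quad[of x y "\<beta> x" "\<beta> z"] that B ne' sign_values[OF abb[of y "\<beta> z" "\<beta> x"]]
          sign_perms[OF abb[of y "\<beta> z" "\<beta> x"]] by auto
      then show ?thesis using sign_perms[OF abb[of y "\<beta> z" "\<beta> x"]] that B ne' by auto
    qed
    note B = \<beta>(1)[OF A(1)] \<beta>(1)[OF A(2)] \<beta>(1)[OF A(3)]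
    have ne': "\<beta> a' \<noteq> \<beta> a''" using ne[of a' a'' a] A d R by auto
    \<comment> \<open>The crossing is found on \<open>a, \<beta> a', a', \<beta> a''\<close>, whose
      four signs are now shown to be +.\<close>
    have "\<chi> (a, \<beta> a', a') = 1"
      using R_iff[of a' a] sign_perms[OF aba[of a' a "\<beta> a'"]] sign_values[OF aba[of a' a "\<beta> a'"]] A B d R by auto
    moreover have "\<chi> (a, \<beta> a', \<beta> a'') = 1"
      using nxt[of a'' a a'] sign_perms[OF abb[of a "\<beta> a''" "\<beta> a'"]] A B d R ne' by auto
    moreover have "\<chi> (a, a', \<beta> a'') = 1"
      using skip[of a'' a a'] sign_perms[OF aba[of a' a "\<beta> a''"]] A B d R by auto
    moreover have "\<chi> (\<beta> a', a', \<beta> a'') = 1"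
      using \<beta>neg[of a' "\<beta> a''"] sign_perms[OF abb[of a' "\<beta> a''" "\<beta> a'"]] A B ne' by auto
    ultimately show False using crossing[of a a' "\<beta> a'" "\<beta> a''"] A B d ne' by auto
  qed
  have "\<exists>a\<in>A. \<forall>a'\<in>A - {a}. ?R a a'"
  proof (rule transitive_tournament_source[OF fin(1) ne(1)])
    show "?R x y \<or> ?R y x" if "x \<in> A" "y \<in> A" "x \<noteq> y" for x y using R_iff[OF that] by blast
    show "?R x z" if "x \<in> A" "y \<in> A" "z \<in> A" "distinct [x, y, z]" "?R x y" "?R y z" for x y z
      using no_cycle[of x y z] R_iff[of x z] that by auto
  qed
  then obtain a where a: "a \<in> A" "\<And>a'. a' \<in> A - {a} \<Longrightarrow> ?R a a'" by blast
  have "separates n \<chi> a (\<beta> a) A B"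
    unfolding separates_def using a \<beta>(1)[OF a(1)] \<beta>neg[OF a(1)] aba abb by auto
  then show ?thesis unfolding strongly_separable_def using a(1) \<beta>(1) by blast
qed

lemma strongly_separable_one_common:
  assumes x: "A \<inter> B = {x}"
  shows "strongly_separable n \<chi> A B"
proof (cases "A \<union> B = {x}")
  case True
  \<comment> \<open>Here the degenerate pair \<open>i = j = x\<close> separates vacuously.\<close>
  then have "A = {x}" "B = {x}" using x by auto
  then show ?thesis unfolding strongly_separable_def separates_def by simp
next
  case False
  define S where "S = (A \<union> B) - {x}"
  \<comment> \<open>On \<open>S\<close>, which avoids the only common point, \<open>e z\<close> is
    the sign that separation demands of \<open>z\<close>.\<close>
  define e where "e = (\<lambda>z. if z \<in> A then 1 else - 1 :: int)"
  \<comment> \<open>The factor \<open>e z\<close> reverses the pair: a source \<open>z\<close> separates as \<open>z x\<close> if \<open>z \<in> A\<close>, and as \<open>x z\<close> if \<open>z \<in> B\<close>.\<close>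
  let ?R = "\<lambda>z w. \<chi> (z, x, w) = e z * e w"
  have S: "finite S" "S \<noteq> {}"
    using False x sub finite_subset[OF sub(1)] finite_subset[OF sub(2)] unfolding S_def by auto
  have t: "(z, x, w) \<in> triples n" if "z \<in> S" "w \<in> S" "z \<noteq> w" for z w
    using that sub x unfolding S_def triples_def by auto
  have e: "e z = 1 \<or> e z = -1" for z unfolding e_def by auto
  have R_iff: "?R z w \<longleftrightarrow> \<not> ?R w z" if "z \<in> S" "w \<in> S" "z \<noteq> w" for z w
    using sign_perms[OF t[OF that]] sign_values[OF t[OF that]] e[of z] e[of w] by auto
  \<comment> \<open>If \<open>z\<close> and \<open>x\<close> form the separating pair of the
    quadruple, in either order, then \<open>z\<close> beats both \<open>w\<close> and
    \<open>v\<close> or loses to both. No vertex of a cycle does so.\<close>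
  have no_pivot: False
    if T: "z \<in> S" "w \<in> S" "v \<in> S" "distinct [z, w, v]" and R: "?R z w" "?R v z"
      and s: "separates n \<chi> z x (A \<inter> {x, z, w, v}) (B \<inter> {x, z, w, v}) \<or>
        separates n \<chi> x z (A \<inter> {x, z, w, v}) (B \<inter> {x, z, w, v})" for z w v
    using s
  proof
    assume s: "separates n \<chi> z x (A \<inter> {x, z, w, v}) (B \<inter> {x, z, w, v})"
    have "\<chi> (z, x, u) = e u" if "u = w \<or> u = v" for u
      using s T that x unfolding separates_def e_def S_def by auto
    then show False using R R_iff[of z v] T e[of z] e[of w] e[of v] by auto
  next
    assume s: "separates n \<chi> x z (A \<inter> {x, z, w, v}) (B \<inter> {x, z, w, v})"
    have "\<chi> (z, x, u) = - e u" if u: "u = w \<or> u = v" for u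
    proof -
      have "\<chi> (x, z, u) = e u"
        using s T u x unfolding separates_def e_def S_def by auto
      then show ?thesis using sign_perms(1)[OF t[of z u]] T u by auto
    qed
    then show False using R R_iff[of z v] T e[of z] e[of w] e[of v] by auto
  qed
  have no_cycle: False
    if T: "z \<in> S" "w \<in> S" "v \<in> S" "distinct [z, w, v]" and R: "?R z w" "?R w v" "?R v z" for z w v
  proof -
    let ?C = "{x, z, w, v}"
    have "?C \<subseteq> A \<union> B" "card ?C = 4"
      using T x unfolding S_def by (auto simp: card_insert_if)
    from sep[OF this] obtain i j where ij: "i \<in> ?C" "j \<in> ?C"
      and s: "separates n \<chi> i j (A \<inter> ?C) (B \<inter> ?C)"
      unfolding separable_def by blast
    \<comment> \<open>The common point \<open>x\<close> belongs to the pair, so the other member is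
      a vertex of the cycle and \<open>no_pivot\<close> applies to it.\<close>
    have "x \<in> {i, j}" using separates_common[OF s, of x] x by auto
    moreover have "i \<noteq> j" using s T unfolding separates_def triples_def S_def by auto
    ultimately obtain u where u: "u \<in> {z, w, v}"
      "separates n \<chi> u x (A \<inter> ?C) (B \<inter> ?C) \<or> separates n \<chi> x u (A \<inter> ?C) (B \<inter> ?C)"
      using ij s by blast
    have C: "{x, w, v, z} = ?C" "{x, v, z, w} = ?C" by auto
    show False
      using u no_pivot[OF T R(1,3)] no_pivot[of w v z] no_pivot[of v z w] T R unfolding C by auto
  qed
  have "\<exists>z\<in>S. \<forall>w\<in>S - {z}. ?R z w"
  proof (rule transitive_tournament_source[OF S])
    show "?R u w \<or> ?R w u" if "u \<in> S" "w \<in> S" "u \<noteq> w" for u w using R_iff[OF that] by auto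
    show "?R u v" if "u \<in> S" "w \<in> S" "v \<in> S" "distinct [u, w, v]" "?R u w" "?R w v" for u w v
      using no_cycle[OF that(1-6)] R_iff[of u v] that(1-4) by auto
  qed
  then obtain z where z: "z \<in> S" "\<And>w. w \<in> S - {z} \<Longrightarrow> ?R z w" by blast
  show ?thesis
  proof (cases "z \<in> A")
    case True
    have "(z, x, w) \<in> triples n \<and> \<chi> (z, x, w) = e w" if "w \<in> (A \<union> B) - {z, x}" for w
      using z(2)[of w] t[of z w] z(1) that True unfolding S_def e_def by auto
    then have "separates n \<chi> z x A B" using x unfolding separates_def e_def by auto
    then show ?thesis using True x unfolding strongly_separable_def by blast
  next
    case False
    have "(x, z, w) \<in> triples n \<and> \<chi> (x, z, w) = e w" if "w \<in> (A \<union> B) - {x, z}" for w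
    proof -
      have w: "w \<in> S" "z \<noteq> w" using that unfolding S_def by auto
      have "\<chi> (z, x, w) = - e w" using z(2)[of w] w False unfolding e_def by auto
      then show ?thesis
        using sign_perms(1)[OF t[OF z(1) w]] t[OF z(1) w] by (auto simp: triples_def)
    qed
    then have "separates n \<chi> x z A B" using x unfolding separates_def e_def by auto
    then show ?thesis using False z(1) x unfolding strongly_separable_def S_def by blast
  qed
qed

text \<open>Any quadruple containing \<open>x\<close> and \<open>y\<close> can only be separated by
  these two, in one of the two orders. Quadruples link any two further points, so one order serves
  all of them at once.\<close>

lemma strongly_separable_two_common:
  assumes x: "A \<inter> B = {x, y}" "x \<noteq> y"
  shows "strongly_separable n \<chi> A B"
proof -
  define e where "e = (\<lambda>z. if z \<in> A then 1 else - 1 :: int)"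
  define S where "S = (A \<union> B) - {x, y}"
  have t: "(x, y, z) \<in> triples n" if "z \<in> S" for z
  proof -
    have "x \<in> {1..n}" "y \<in> {1..n}" "z \<in> {1..n}" using that sub x(1) unfolding S_def by blast+
    then show ?thesis using that x(2) unfolding S_def triples_def by simp
  qed
  have same: "(\<chi> (x, y, z) = e z) = (\<chi> (x, y, w) = e w)" if "z \<in> S" "w \<in> S" for z w
  proof (cases "z = w")
    case False
    let ?C = "{x, y, z, w}"
    have "?C \<subseteq> A \<union> B" "card ?C = 4"
      using that x False unfolding S_def by (auto simp: card_insert_if)
    from sep[OF this] obtain i j where s: "separates n \<chi> i j (A \<inter> ?C) (B \<inter> ?C)"
      unfolding separable_def by blast
    have "x \<in> {i, j}" "y \<in> {i, j}" using separates_common[OF s] x(1) by auto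
    then consider "i = x" "j = y" | "i = y" "j = x" using x(2) by auto
    then show ?thesis
    proof cases
      case 1
      have "\<chi> (x, y, u) = e u" if "u = z \<or> u = w" for u
        using s \<open>z \<in> S\<close> \<open>w \<in> S\<close> that 1 unfolding separates_def e_def S_def by auto
      then show ?thesis by auto
    next
      case 2
      have "\<chi> (y, x, u) = e u" if "u = z \<or> u = w" for u
        using s \<open>z \<in> S\<close> \<open>w \<in> S\<close> that 2 unfolding separates_def e_def S_def by auto
      then show ?thesis
        using sign_perms(1)[OF t[OF that(1)]] sign_perms(1)[OF t[OF that(2)]]
        unfolding e_def by (auto split: if_splits)
    qed
  qed simp
  show ?thesis
  proof (cases "\<forall>z\<in>S. \<chi> (x, y, z) = e z")
    case True
    then have "separates n \<chi> x y A B"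
      using t x unfolding separates_def e_def S_def by auto
    then show ?thesis using x unfolding strongly_separable_def by blast
  next
    case False
    have "(y, x, z) \<in> triples n \<and> \<chi> (y, x, z) = e z" if "z \<in> S" for z
    proof -
      have "\<chi> (x, y, z) \<noteq> e z" using False same that by blast
      then show ?thesis
        using sign_perms(1)[OF t[OF that]] sign_values[OF t[OF that]] t[OF that]
        by (auto simp: triples_def e_def split: if_splits)
    qed
    then have "separates n \<chi> y x A B"
      using x unfolding separates_def e_def S_def by auto
    then show ?thesis using x unfolding strongly_separable_def by blast
  qed
qed

text \<open>A quadruple with three common points is inseparable, since a pair would have to contain
  all three. In the exceptional case \<open>A = B\<close> with three points there is no quadruple to
  test.\<close>

lemma three_common:
  assumes "card (A \<inter> B) \<ge> 3"
  shows "A = B \<and> card A = 3"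
proof (rule ccontr)
  assume neg: "\<not> ?thesis"
  have fin: "finite (A \<union> B)" using sub finite_subset[OF _ finite_atLeastAtMost[of 1 n]] by auto
  obtain D where D: "D \<subseteq> A \<inter> B" "card D = 3" using obtain_subset_with_card_n[OF assms] by blast
  \<comment> \<open>A fourth point exists because otherwise both sets would equal \<open>D\<close>,
    which is the excluded case.\<close>
  obtain v where v: "v \<in> A \<union> B" "v \<notin> D"
  proof -
    have "\<not> A \<union> B \<subseteq> D"
    proof
      assume "A \<union> B \<subseteq> D"
      then have "A = D" "B = D" using D(1) by blast+
      then show False using D(2) neg by simp
    qed
    then show thesis using that by blast
  qed
  have "finite D" using D fin finite_subset by blast
  then have "insert v D \<subseteq> A \<union> B" "card (insert v D) = 4" using v D by auto
  from sep[OF this] obtain i j where s: "separates n \<chi> i j (A \<inter> insert v D) (B \<inter> insert v D)"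
    unfolding separable_def by blast
  have "u \<in> {i, j}" if "u \<in> D" for u
    using separates_common[OF s, of u] D that by auto
  then have "card D \<le> card {i, j}" by (intro card_mono) auto
  then show False using D by (auto simp: card_insert_if split: if_splits)
qed

end

end

section \<open>Combination of the cases\<close>

theorem theorem1:
  fixes n :: nat and \<chi> :: "nat \<times> nat \<times> nat \<Rightarrow> int" and A B :: "nat set"
  assumes "generalized_signotope n \<chi>"
    and "A \<subseteq> {1..n}" and "B \<subseteq> {1..n}"
    and "A \<noteq> {}" and "B \<noteq> {}"
    and "\<not> (A = B \<and> card A = 3)"
    and "\<And>C. C \<subseteq> A \<union> B \<Longrightarrow> card C = 4 \<Longrightarrow> separable n \<chi> (A \<inter> C) (B \<inter> C)"
  shows "strongly_separable n \<chi> A B"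
proof -
  have fin: "finite (A \<inter> B)" using assms(2) finite_subset by blast
  have "card (A \<inter> B) < 3"
    using three_common[OF assms(1-3,7)] assms(6) by (meson not_less)
  then consider "card (A \<inter> B) = 0" | "card (A \<inter> B) = 1" | "card (A \<inter> B) = 2" by linarith
  then show ?thesis
  proof cases
    case 1
    then show ?thesis using strongly_separable_disjoint[OF assms(1-3,7)] assms(4,5) fin by simp
  next
    case 2
    then obtain x where "A \<inter> B = {x}" by (auto simp: card_1_singleton_iff)
    then show ?thesis using strongly_separable_one_common[OF assms(1-3,7)] by blast
  next
    case 3
    then obtain x y where "A \<inter> B = {x, y}" "x \<noteq> y" by (auto simp: card_2_iff)
    then show ?thesis using strongly_separable_two_common[OF assms(1-3,7)] by blast
  qed
qed

end
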